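(* Let $m_1,m_2,n,D$ be positive integers such that $6m_1\log n<m_2$ and $16Dm_2\leqslant n$, and assume that $n$ is sufficiently large. Let $H$ be a graph on $n$ vertices such that $H$ is (1) a weak $(m_1,n/32D)$-expander, and (2) a weak $(m_2,m_2)$-expander. Then $H$ contains every tree $T\in\mathcal{T}(n-m_1,D)$ with at least $24Dm_2$ leaves.
   Context: For a graph $H$ and disjoint $X,Y\subseteq V(H)$, $e(X,Y)$ denotes the number of edges with one endpoint in $X$ and the other in $Y$. A graph $H$ is a weak $(a,b)$-expander if $e(X,Y)>0$ for all disjoint sets $X,Y\subseteq V(H)$ with $|X|=a$ and $|Y|=b$. $\mathcal{T}(k,D)$ denotes the class of all trees with $k$ edges and maximum degree at most $D$. "Contains" means contains as a (not necessarily induced) subgraph. *)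

theory Defs
  imports Complex_Main
begin

text \<open>
  Finite simple graphs are pairs (vertex set, edge set), with edges as two-element sets of
  vertices.  The digraph-based AFP entry Graph_Theory is not used: its notion of a tree forbids
  all directed cycles, and in a symmetric digraph every edge traversed back and forth is one.
\<close>

type_synonym 'a graph = "'a set \<times> 'a set set"

abbreviation verts :: "'a graph \<Rightarrow> 'a set" where
  "verts G \<equiv> fst G"

abbreviation edges :: "'a graph \<Rightarrow> 'a set set" where
  "edges G \<equiv> snd G"

definition simple_graph :: "'a graph \<Rightarrow> bool" where
  "simple_graph G \<longleftrightarrow> finite (verts G) \<and> (\<forall>e\<in>edges G. e \<subseteq> verts G \<and> card e = 2)"

definition degree :: "'a graph \<Rightarrow> 'a \<Rightarrow> nat" where
  "degree G v = card {e \<in> edges G. v \<in> e}"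

definition leaves :: "'a graph \<Rightarrow> 'a set" where
  "leaves G = {v \<in> verts G. degree G v = 1}"

definition connected_graph :: "'a graph \<Rightarrow> bool" where
  "connected_graph G \<longleftrightarrow> verts G \<noteq> {} \<and>
     (\<forall>u\<in>verts G. \<forall>v\<in>verts G. (u, v) \<in> {(x, y). {x, y} \<in> edges G}\<^sup>*)"

text \<open>A cycle is given by its vertices in cyclic order, without repeating the first one.\<close>

definition is_cycle :: "'a graph \<Rightarrow> 'a list \<Rightarrow> bool" where
  "is_cycle G p \<longleftrightarrow> 3 \<le> length p \<and> distinct p \<and>
     (\<forall>i. Suc i < length p \<longrightarrow> {p ! i, p ! Suc i} \<in> edges G) \<and> {last p, hd p} \<in> edges G"

definition is_tree :: "'a graph \<Rightarrow> bool" where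
  "is_tree G \<longleftrightarrow> simple_graph G \<and> connected_graph G \<and> (\<nexists>p. is_cycle G p)"

definition bounded_degree_trees :: "nat \<Rightarrow> nat \<Rightarrow> 'a graph set" where
  "bounded_degree_trees k D =
     {T. is_tree T \<and> card (edges T) = k \<and> (\<forall>v\<in>verts T. degree T v \<le> D)}"

definition edges_between :: "'a graph \<Rightarrow> 'a set \<Rightarrow> 'a set \<Rightarrow> nat" where
  "edges_between G X Y = card {e \<in> edges G. \<exists>x\<in>X. \<exists>y\<in>Y. e = {x, y}}"

text \<open>
  Set sizes are integers: a non-integral parameter such as n / (32 D) is rounded up where this
  predicate is used.  As the property is monotone in b, it then says the same as the condition
  for all Y with at least n / (32 D) elements.
\<close>

definition weak_expander :: "'a graph \<Rightarrow> nat \<Rightarrow> nat \<Rightarrow> bool" where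
  "weak_expander G a b \<longleftrightarrow>
     (\<forall>X Y. X \<subseteq> verts G \<and> Y \<subseteq> verts G \<and> X \<inter> Y = {} \<and> card X = a \<and> card Y = b
        \<longrightarrow> edges_between G X Y > 0)"

definition contains_copy :: "'a graph \<Rightarrow> 'b graph \<Rightarrow> bool" where
  "contains_copy G F \<longleftrightarrow>
     (\<exists>f. inj_on f (verts F) \<and> f ` verts F \<subseteq> verts G \<and> (\<forall>e\<in>edges F. f ` e \<in> edges G))"

end

theory Submission
  imports Defs
begin

text \<open>
  Let \<open>L\<close> be the set of leaves of \<open>T\<close> other than a chosen root. A random set \<open>M\<close> of
  \<open>8 D m\<^sub>2\<close> vertices of \<open>H\<close> has the property that every \<open>m\<^sub>1\<close>-set is non-adjacent to fewer than
  \<open>m\<^sub>2\<close> vertices of \<open>M\<close>: the expected number of bad pairs is at most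
  \<open>n^m\<^sub>1 (e/4)^m\<^sub>2 < 1\<close>. Colour the vertices of \<open>H\<close> by membership in \<open>M\<close>. A Friedman--Pippenger
  argument embeds \<open>T - L\<close> so that \<open>2 m\<^sub>2\<close> parents of leaves in \<open>L\<close> land in \<open>M\<close> and everything
  else lands outside \<open>M\<close>, while every set of at most \<open>2 m\<^sub>2\<close> vertices keeps enough unused neighbours
  outside \<open>M\<close> for its leaves. The leaves are then placed by Hall's theorem among the unused
  vertices. Small sets satisfy Hall's condition by the embedding invariant. If a set of more than
  \<open>2 m\<^sub>2\<close> images of parents violates it, the set of unused non-neighbours has between \<open>m\<^sub>1\<close> and
  \<open>m\<^sub>2\<close> elements and hence is adjacent to more than \<open>m\<^sub>2\<close> images in \<open>M\<close>; these parents lie outside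
  the violating set, and their leaves make the violation impossible.
\<close>

section \<open>Tight sets and Hall's theorem\<close>

text \<open>
  By submodularity the tight sets avoiding \<open>x0\<close> (those with no spare neighbour) have a largest
  member \<open>Z\<close>. If every neighbour \<open>y\<close> of \<open>x0\<close> were adjacent to \<open>Z\<close>, adding \<open>x0\<close> to \<open>Z\<close> would break
  the neighbourhood condition. The size bound \<open>k\<close> is the one of Friedman and Pippenger; with
  \<open>k > 2 * card U\<close> the same step proves Hall's theorem.
\<close>

lemma demand_step:
  fixes N :: "'a \<Rightarrow> 'b set" and d :: "'a \<Rightarrow> nat"
  assumes fU: "finite U" and fN: "\<And>x. x \<in> U \<Longrightarrow> finite (N x)"
    and hall: "\<And>X. X \<subseteq> U \<Longrightarrow> card X \<le> k \<Longrightarrow> sum d X \<le> card (\<Union>(N ` X))"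
    and small: "\<And>X. X \<subseteq> U \<Longrightarrow> card X \<le> k \<Longrightarrow> card (\<Union>(N ` X)) = sum d X \<Longrightarrow> 2 * card X < k"
    and x0: "x0 \<in> U" "d x0 \<ge> 1"
  obtains y where "y \<in> N x0"
    "\<And>X. X \<subseteq> U \<Longrightarrow> card X \<le> k \<Longrightarrow> sum (d(x0 := d x0 - 1)) X \<le> card (\<Union>(N ` X) - {y})"
proof -
  define tight where
    "tight X \<longleftrightarrow> X \<subseteq> U \<and> card X \<le> k \<and> card (\<Union>(N ` X)) = sum d X \<and> x0 \<notin> X" for X
  have "tight {}" by (simp add: tight_def)
  moreover have "\<forall>X. tight X \<longrightarrow> card X < Suc k" by (simp add: tight_def)
  ultimately obtain Z where Z: "tight Z" and Zmax: "\<And>X. tight X \<Longrightarrow> card X \<le> card Z"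
    using ex_has_greatest_nat[of tight "{}" card] by blast
  have fin: "finite (\<Union>(N ` X))" "finite X" if "X \<subseteq> U" for X
    using that fU fN finite_subset by (auto intro: finite_subset)
  have absorb: "X \<subseteq> Z" if X: "tight X" for X
  proof -
    let ?n = "\<lambda>X. card (\<Union>(N ` X))"
    have XU: "X \<subseteq> U" "Z \<subseteq> U" "X \<union> Z \<subseteq> U" "X \<inter> Z \<subseteq> U" using X Z by (auto simp: tight_def)
    \<comment> \<open>Hypothesis \<open>small\<close> keeps tight sets below half of
      \<open>k\<close>, so the union of two of them is still within reach of
      \<open>hall\<close>.\<close>
    have "2 * card X < k" "2 * card Z < k" using X Z small by (auto simp: tight_def)
    then have un: "card (X \<union> Z) \<le> k" using card_Un_le[of X Z] by linarith
    have "card (X \<inter> Z) \<le> card X" using XU fin by (intro card_mono) auto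
    then have int: "card (X \<inter> Z) \<le> k" using X by (simp add: tight_def)
    \<comment> \<open>Neighbourhood size is submodular and \<open>sum d\<close> is modular. As
      \<open>hall\<close> bounds union and intersection from below, equality for \<open>X\<close>
      and \<open>Z\<close> forces equality for their union.\<close>
    have "?n X + ?n Z = card (\<Union>(N ` X) \<union> \<Union>(N ` Z)) + card (\<Union>(N ` X) \<inter> \<Union>(N ` Z))"
      by (rule card_Un_Int) (use fin XU in auto)
    moreover have "card (\<Union>(N ` X) \<union> \<Union>(N ` Z)) = ?n (X \<union> Z)" by (simp add: image_Un)
    moreover have "?n (X \<inter> Z) \<le> card (\<Union>(N ` X) \<inter> \<Union>(N ` Z))"
      by (rule card_mono) (use fin XU in auto)
    moreover have "sum d (X \<union> Z) + sum d (X \<inter> Z) = sum d X + sum d Z"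
      using sum.union_inter[of X Z d] fin XU by auto
    moreover note hall[OF XU(3) un] hall[OF XU(4) int]
    moreover have "?n X = sum d X" "?n Z = sum d Z" using X Z by (simp_all add: tight_def)
    ultimately have "?n (X \<union> Z) = sum d (X \<union> Z)" by linarith
    then have "tight (X \<union> Z)" using X Z un XU(3) unfolding tight_def by blast
    then have "card (X \<union> Z) \<le> card Z" by (rule Zmax)
    then have "Z = X \<union> Z"
      using card_seteq[of "X \<union> Z" Z] fin XU by auto
    then show ?thesis by blast
  qed
  have "\<exists>y\<in>N x0. y \<notin> \<Union>(N ` Z)"
  proof (rule ccontr)
    assume "\<not> ?thesis"
    then have eq: "\<Union>(N ` (insert x0 Z)) = \<Union>(N ` Z)" by auto
    have "2 * card Z < k" using Z small by (auto simp: tight_def)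
    moreover have cI: "card (insert x0 Z) = Suc (card Z)"
      using Z fin by (auto simp: tight_def)
    ultimately have "sum d (insert x0 Z) \<le> card (\<Union>(N ` (insert x0 Z)))"
      using Z x0 by (intro hall) (auto simp: tight_def)
    moreover have "sum d (insert x0 Z) = d x0 + sum d Z"
      using Z fin by (auto simp: tight_def)
    ultimately show False using Z x0 eq by (auto simp: tight_def)
  qed
  then obtain y where y: "y \<in> N x0" "y \<notin> \<Union>(N ` Z)" by blast
  show thesis
  proof (rule that[OF y(1)])
    fix X assume X: "X \<subseteq> U" "card X \<le> k"
    let ?N = "\<Union>(N ` X)"
    have h: "sum d X \<le> card ?N" using hall X by auto
    have fX: "finite X" "finite ?N" using fin X by auto
    show "sum (d(x0 := d x0 - 1)) X \<le> card (?N - {y})"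
    proof (cases "x0 \<in> X")
      case True
      have "sum (d(x0 := d x0 - 1)) X = d x0 - 1 + sum d (X - {x0})"
        using fX True by (subst sum.remove[of _ x0]) (auto intro!: sum.cong)
      moreover have "sum d X = d x0 + sum d (X - {x0})"
        using sum.remove[OF fX(1) True] .
      moreover have "card ?N - 1 \<le> card (?N - {y})"
        using fX by (simp add: card_Diff_singleton_if)
      ultimately show ?thesis using h x0 by linarith
    next
      case False
      then have eq: "sum (d(x0 := d x0 - 1)) X = sum d X" by (intro sum.cong) auto
      show ?thesis
      proof (cases "y \<in> ?N")
        case True
        \<comment> \<open>Losing \<open>y\<close> can only hurt a set without spare neighbour, but
          all such sets avoiding \<open>x0\<close> lie in \<open>Z\<close>, which is not adjacent to
          \<open>y\<close>.\<close>
        then have "\<not> X \<subseteq> Z" using y by blast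
        then have "\<not> tight X" using absorb by blast
        then have "card ?N \<noteq> sum d X" using X False by (auto simp: tight_def)
        moreover have "card (?N - {y}) = card ?N - 1" using fX True by simp
        ultimately show ?thesis using h eq by linarith
      next
        case False
        then show ?thesis using h eq by simp
      qed
    qed
  qed
qed

lemma hall_marriage:
  fixes N :: "'a \<Rightarrow> 'b set"
  assumes "finite I" "\<And>i. i \<in> I \<Longrightarrow> finite (N i)"
    "\<And>J. J \<subseteq> I \<Longrightarrow> card J \<le> card (\<Union>(N ` J))"
  shows "\<exists>g. inj_on g I \<and> (\<forall>i\<in>I. g i \<in> N i)"
  using assms
proof (induction I arbitrary: N rule: finite_induct)
  case empty
  then show ?case by auto
next
  case (insert i I)
  have le: "card X \<le> Suc (card I)" if "X \<subseteq> insert i I" for X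
    using card_mono[OF _ that] insert.hyps by simp
  \<comment> \<open>The bound is twice \<open>card (insert i I)\<close> plus one, so
    \<open>small\<close> holds for every subset. With the demand of \<open>i\<close> reduced to 0,
    the result is Hall's condition for \<open>I\<close> after the removal of
    \<open>y\<close>.\<close>
  obtain y where y: "y \<in> N i" "\<And>X. X \<subseteq> insert i I \<Longrightarrow> card X \<le> 2 * card I + 3 \<Longrightarrow>
      sum ((\<lambda>_. 1::nat)(i := 1 - 1)) X \<le> card (\<Union>(N ` X) - {y})"
  proof (rule demand_step[of "insert i I" N "2 * card I + 3" "\<lambda>_. 1" i])
    show "2 * card X < 2 * card I + 3" if "X \<subseteq> insert i I" for X
      using le[OF that] by simp
  qed (use insert.prems insert.hyps(1) in simp_all)
  have "card J \<le> card (\<Union>((\<lambda>j. N j - {y}) ` J))" if J: "J \<subseteq> I" for J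
  proof -
    have "J \<subseteq> insert i I" "i \<notin> J" using J insert.hyps by auto
    moreover from this have "sum ((\<lambda>_. 1::nat)(i := 1 - 1)) J = sum (\<lambda>_. 1) J"
      by (intro sum.cong) auto
    moreover have "\<Union>((\<lambda>j. N j - {y}) ` J) = \<Union>(N ` J) - {y}" by auto
    ultimately show ?thesis using y(2)[of J] le[of J] by simp
  qed
  then obtain g where g: "inj_on g I" "\<forall>j\<in>I. g j \<in> N j - {y}"
    using insert.IH[of "\<lambda>j. N j - {y}"] insert.prems(1) by blast
  have "inj_on (g(i := y)) (insert i I)" "\<forall>j\<in>insert i I. (g(i := y)) j \<in> N j"
    using g y insert.hyps by (auto simp: inj_on_def)
  then show ?case by blast
qed

section \<open>Rooted trees\<close>

text \<open>A connected set is grown from \<open>r\<close> along edges leaving it. A new vertex has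
  only one neighbour in the set, since a second one and a path inside the set would close a cycle.
  That neighbour becomes its parent, and the stage of insertion its rank.\<close>

lemma tree_parent:
  assumes tree: "is_tree T" and r: "r \<in> verts T"
  obtains par rank where
    "\<And>v. v \<in> verts T - {r} \<Longrightarrow> par v \<in> verts T \<and> rank (par v) < (rank v :: nat)"
    "edges T = (\<lambda>v. {v, par v}) ` (verts T - {r})"
proof -
  let ?E = "edges T" and ?V = "verts T"
  have fV: "finite ?V" and E: "\<And>e. e \<in> ?E \<Longrightarrow> e \<subseteq> ?V \<and> card e = 2"
    using tree by (auto simp: is_tree_def simple_graph_def)
  let ?adj = "\<lambda>x y. {x, y} \<in> ?E"
  define joined where "joined S a b \<longleftrightarrow> (\<exists>p. p \<noteq> [] \<and> distinct p \<and> set p \<subseteq> S \<and> hd p = a \<and>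
      last p = b \<and> successively ?adj p)" for S a b
  define ok where "ok k S par rank \<longleftrightarrow> S \<subseteq> ?V \<and> r \<in> S \<and> card S = Suc k \<and>
      (\<forall>a\<in>S. \<forall>b\<in>S. joined S a b) \<and>
      (\<forall>v\<in>S - {r}. par v \<in> S \<and> rank (par v) < (rank v :: nat)) \<and>
      {e \<in> ?E. e \<subseteq> S} = (\<lambda>v. {v, par v}) ` (S - {r}) \<and> (\<forall>v\<in>S. rank v \<le> k)"
    for k S par rank
  have "\<exists>S par rank. ok k S par rank" if "Suc k \<le> card ?V" for k
    using that
  proof (induction k)
    case 0
    have "{e \<in> ?E. e \<subseteq> {r}} = {}"
      using E by (fastforce simp: subset_singleton_iff)
    moreover have "joined {r} r r"
      unfolding joined_def by (intro exI[of _ "[r]"]) auto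
    ultimately show ?case
      using r by (intro exI[of _ "{r}"] exI[of _ "\<lambda>_. r"] exI[of _ "\<lambda>_. 0"]) (auto simp: ok_def)
  next
    case (Suc k)
    then have "Suc k \<le> card ?V" by simp
    from Suc.IH[OF this] obtain S par rank where "ok k S par rank" by blast
    then have S: "S \<subseteq> ?V" "r \<in> S" "card S = Suc k"
      and joined': "\<forall>a\<in>S. \<forall>b\<in>S. joined S a b"
      and par: "\<forall>v\<in>S - {r}. par v \<in> S \<and> rank (par v) < rank v"
      and ES: "{e \<in> ?E. e \<subseteq> S} = (\<lambda>v. {v, par v}) ` (S - {r})"
      and rank: "\<forall>v\<in>S. rank v \<le> k" unfolding ok_def by simp_all
    have joined: "joined S a b" if "a \<in> S" "b \<in> S" for a b
      using joined' that by blast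
    have "S \<noteq> ?V" using S Suc.prems by auto
    then obtain w where w: "w \<in> ?V" "w \<notin> S" using S by blast
    have "(r, w) \<in> {(x, y). ?adj x y}\<^sup>*"
      using tree r w by (auto simp: is_tree_def connected_graph_def)
    then have "\<exists>u v. u \<in> S \<and> v \<notin> S \<and> ?adj u v"
      using w(2) S(2) by (induction rule: rtrancl_induct) auto
    then obtain u v where uv: "u \<in> S" "v \<notin> S" "?adj u v" by blast
    then have vV: "v \<in> ?V" using E by blast
    have uniq: "u' = u" if u': "u' \<in> S" "?adj u' v" for u'
    proof (rule ccontr)
      assume ne: "u' \<noteq> u"
      obtain p where p: "p \<noteq> []" "distinct p" "set p \<subseteq> S" "hd p = u" "last p = u'" "successively ?adj p"
        using joined[OF uv(1) u'(1)] by (auto simp: joined_def)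
      have "length p \<noteq> 1" using p ne by (cases p) auto
      then have "length p \<ge> 2" using p(1) by (cases p) (auto simp: Suc_le_eq)
      moreover have "successively ?adj (p @ [v])"
        using p u' by (auto simp: successively_append_iff)
      ultimately have "is_cycle T (p @ [v])"
        unfolding is_cycle_def using p uv
        by (auto simp: successively_conv_nth insert_commute)
      then show False using tree by (auto simp: is_tree_def)
    qed
    let ?S = "insert v S" and ?par = "par(v := u)" and ?rank = "rank(v := Suc k)"
    have sub: "joined ?S a b" if "a \<in> S" "b \<in> S" for a b
      using joined[OF that] unfolding joined_def by blast
    have av: "joined ?S a v" if a: "a \<in> S" for a
    proof -
      obtain p where p: "p \<noteq> []" "distinct p" "set p \<subseteq> S" "hd p = a" "last p = u" "successively ?adj p"
        using joined[OF a uv(1)] by (auto simp: joined_def)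
      then show ?thesis unfolding joined_def
        by (intro exI[of _ "p @ [v]"]) (use uv in \<open>auto simp: successively_append_iff\<close>)
    qed
    have va: "joined ?S v a" if a: "a \<in> S" for a
    proof -
      obtain p where p: "p \<noteq> []" "distinct p" "set p \<subseteq> S" "hd p = u" "last p = a" "successively ?adj p"
        using joined[OF uv(1) a] by (auto simp: joined_def)
      then show ?thesis unfolding joined_def
        by (intro exI[of _ "v # p"]) (use uv in \<open>auto simp: successively_Cons insert_commute\<close>)
    qed
    have "joined ?S v v"
      unfolding joined_def by (intro exI[of _ "[v]"]) auto
    then have 1: "\<forall>a\<in>?S. \<forall>b\<in>?S. joined ?S a b" using sub av va by auto
    have 2: "\<forall>x\<in>?S - {r}. ?par x \<in> ?S \<and> ?rank (?par x) < ?rank x"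
    proof
      fix x assume x: "x \<in> ?S - {r}"
      show "?par x \<in> ?S \<and> ?rank (?par x) < ?rank x"
      proof (cases "x = v")
        case True
        then show ?thesis using uv rank by (auto simp: less_Suc_eq_le)
      next
        case False
        then have "par x \<in> S \<and> rank (par x) < rank x" using x par by auto
        then show ?thesis using False uv by auto
      qed
    qed
    have "{e \<in> ?E. e \<subseteq> ?S} = insert {v, u} {e \<in> ?E. e \<subseteq> S}"
    proof (intro equalityI subsetI)
      fix e assume e: "e \<in> {e \<in> ?E. e \<subseteq> ?S}"
      show "e \<in> insert {v, u} {e \<in> ?E. e \<subseteq> S}"
      proof (cases "v \<in> e")
        case True
        obtain a b where ab: "e = {a, b}" "a \<noteq> b"
          using E[of e] e by (auto simp: card_2_iff)
        then obtain c where "e = {c, v}" "c \<noteq> v" using True by auto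
        moreover then have "c \<in> S" using e by auto
        ultimately show ?thesis using uniq[of c] e by auto
      next
        case False
        then show ?thesis using e by auto
      qed
    next
      fix e assume "e \<in> insert {v, u} {e \<in> ?E. e \<subseteq> S}"
      then show "e \<in> {e \<in> ?E. e \<subseteq> ?S}" using uv by (auto simp: insert_commute)
    qed
    also have "\<dots> = (\<lambda>x. {x, ?par x}) ` (?S - {r})"
    proof -
      have "v \<noteq> r" using uv S by auto
      then have "?S - {r} = insert v (S - {r})" by auto
      moreover have "(\<lambda>x. {x, ?par x}) ` (S - {r}) = (\<lambda>x. {x, par x}) ` (S - {r})"
        using uv by (intro image_cong) auto
      ultimately show ?thesis using ES by simp
    qed
    finally have 3: "{e \<in> ?E. e \<subseteq> ?S} = (\<lambda>x. {x, ?par x}) ` (?S - {r})" .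
    have 4: "?S \<subseteq> ?V" "r \<in> ?S" "card ?S = Suc (Suc k)" "\<forall>x\<in>?S. ?rank x \<le> Suc k"
      using S vV uv finite_subset[OF S(1) fV] rank by (auto simp: le_SucI)
    have "ok (Suc k) ?S ?par ?rank" unfolding ok_def using 1 2 3 4 by simp
    then show ?case by blast
  qed
  moreover have V: "Suc (card ?V - 1) = card ?V"
    using r fV by (metis Suc_diff_1 card_gt_0_iff empty_iff)
  ultimately obtain S par rank where "ok (card ?V - 1) S par rank" by (metis order_refl)
  then have S: "S \<subseteq> ?V" "card S = card ?V"
    and par: "\<forall>v\<in>S - {r}. par v \<in> S \<and> rank (par v) < rank v"
    and ES: "{e \<in> ?E. e \<subseteq> S} = (\<lambda>v. {v, par v}) ` (S - {r})" unfolding ok_def using V by auto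
  have "S = ?V" using S fV by (simp add: card_subset_eq)
  moreover have "{e \<in> ?E. e \<subseteq> ?V} = ?E" using E by blast
  ultimately show thesis using that[of par rank] par ES by auto
qed

text \<open>Children give distinct incident edges. Away from the root the edge to the parent is one
  more, since ranks forbid two vertices to be parents of each other. The strict form later shows
  that a leaf other than the root has no child.\<close>

lemma child_count_le_degree:
  assumes "simple_graph T" "edges T = (\<lambda>v. {v, par v}) ` (verts T - {r})"
    and "\<And>v. v \<in> verts T - {r} \<Longrightarrow> par v \<in> verts T \<and> rank (par v) < (rank v :: nat)"
  shows "card {t \<in> verts T - {r}. par t = s} \<le> degree T s"
    and "s \<in> verts T - {r} \<Longrightarrow> card {t \<in> verts T - {r}. par t = s} < degree T s"
proof -
  let ?C = "{t \<in> verts T - {r}. par t = s}" and ?I = "{e \<in> edges T. s \<in> e}"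
  have fI: "finite ?I" using assms(1,2) by (simp add: simple_graph_def)
  have inj: "inj_on (\<lambda>t. {t, s}) ?C"
    by (auto simp: inj_on_def doubleton_eq_iff)
  have sub: "(\<lambda>t. {t, s}) ` ?C \<subseteq> ?I" using assms(2) by auto
  show "card ?C \<le> degree T s"
    unfolding degree_def using card_inj_on_le[OF inj sub fI] .
  assume s: "s \<in> verts T - {r}"
  have "{s, par s} \<notin> (\<lambda>t. {t, s}) ` ?C"
  proof
    assume "{s, par s} \<in> (\<lambda>t. {t, s}) ` ?C"
    then obtain t where "t \<in> ?C" "{s, par s} = {t, s}" by blast
    then show False using assms(3)[of t] assms(3)[OF s] by (auto simp: doubleton_eq_iff)
  qed
  moreover have "{s, par s} \<in> ?I" using s assms(2) by auto
  ultimately have "(\<lambda>t. {t, s}) ` ?C \<subset> ?I" using sub by blast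
  then have "card ((\<lambda>t. {t, s}) ` ?C) < card ?I" using fI by (rule psubset_card_mono[rotated])
  then show "card ?C < degree T s" unfolding degree_def using card_image[OF inj] by simp
qed

lemma card_tree_edges:
  assumes "finite (verts T)" "r \<in> verts T" "edges T = (\<lambda>v. {v, par v}) ` (verts T - {r})"
    and "\<And>v. v \<in> verts T - {r} \<Longrightarrow> par v \<in> verts T \<and> rank (par v) < (rank v :: nat)"
  shows "card (verts T) = Suc (card (edges T))"
proof -
  have "inj_on (\<lambda>v. {v, par v}) (verts T - {r})"
  proof (rule inj_onI, rule ccontr)
    fix v w assume vw: "v \<in> verts T - {r}" "w \<in> verts T - {r}" "{v, par v} = {w, par w}" "v \<noteq> w"
    then have "v = par w" "w = par v" by (auto simp: doubleton_eq_iff)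
    then show False using assms(4)[OF vw(1)] assms(4)[OF vw(2)] by simp
  qed
  then have "card (edges T) = card (verts T - {r})" using assms(3) card_image by metis
  then show ?thesis using assms(1,2) by (metis card.remove)
qed

section \<open>A random reservoir\<close>

text \<open>Factor by factor, \<open>(s - i) / (n - i)\<close> is at most \<open>s / n\<close>. This
  bounds the probability that a random \<open>s\<close>-subset of \<open>n\<close> points contains a
  given \<open>m\<close>-set.\<close>

lemma binomial_ratio_le:
  assumes "s \<le> n" "0 < n"
  shows "real (s choose m) * real n ^ m \<le> real s ^ m * real (n choose m)"
proof (cases "m \<le> s")
  case False
  then show ?thesis by (simp add: binomial_eq_0)
next
  case True
  have "real (s choose m) * real n ^ m = (\<Prod>i<m. real n * (real (s - i) / real (m - i)))"
    using True by (simp add: binomial_altdef_of_nat prod.distrib atLeast0LessThan del: of_nat_diff times_divide_eq_right)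
  also have "\<dots> \<le> (\<Prod>i<m. real s * (real (n - i) / real (m - i)))"
  proof (rule prod_mono, safe)
    fix i assume i: "i < m"
    have "real n * real (s - i) \<le> real s * real (n - i)"
      using i True assms mult_left_mono[of "real s" "real n" "real i"]
      by (simp add: algebra_simps)
    then show "real n * (real (s - i) / real (m - i)) \<le> real s * (real (n - i) / real (m - i))"
      by (simp add: divide_right_mono)
  qed simp
  also have "\<dots> = real s ^ m * real (n choose m)"
    using True assms by (simp add: binomial_altdef_of_nat prod.distrib atLeast0LessThan del: of_nat_diff times_divide_eq_right)
  finally show ?thesis .
qed

lemma card_supersets:
  assumes "finite V" "K \<subseteq> V" "card K \<le> s"
  shows "card {M. M \<subseteq> V \<and> card M = s \<and> K \<subseteq> M} = (card V - card K) choose (s - card K)"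
proof -
  have fK: "finite K" using assms finite_subset by blast
  have "bij_betw (\<lambda>M. M - K) {M. M \<subseteq> V \<and> card M = s \<and> K \<subseteq> M} {M. M \<subseteq> V - K \<and> card M = s - card K}"
  proof (rule bij_betw_byWitness[where f' = "\<lambda>M. M \<union> K"])
    show "(\<lambda>M. M \<union> K) ` {M. M \<subseteq> V - K \<and> card M = s - card K} \<subseteq> {M. M \<subseteq> V \<and> card M = s \<and> K \<subseteq> M}"
    proof safe
      fix M assume M: "M \<subseteq> V - K" "card M = s - card K"
      have "card (M \<union> K) = card M + card K"
        using M assms fK finite_subset by (intro card_Un_disjoint) (auto intro: finite_subset)
      then show "card (M \<union> K) = s" using M assms by simp
    qed (use assms in auto)
  qed (use fK in \<open>auto simp: card_Diff_subset\<close>)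
  then have "card {M. M \<subseteq> V \<and> card M = s \<and> K \<subseteq> M} = card {M. M \<subseteq> V - K \<and> card M = s - card K}"
    by (rule bij_betw_same_card)
  also have "\<dots> = (card V - card K) choose (s - card K)"
    using assms fK by (simp add: n_subsets card_Diff_subset)
  finally show ?thesis .
qed

text \<open>First-moment argument in counting form: the \<open>s\<close>-sets that contain an
  \<open>m\<close>-subset of some member of \<open>Z\<close> make up a proportion of at most
  \<open>card Z\<close> times \<open>(exp 1 / 4) ^ m\<close>, which is less than 1.\<close>

lemma exists_reservoir:
  assumes fV: "finite V" and nV: "card V = n" "0 < n" and fZ: "finite Z"
    and sub: "\<And>A. A \<in> Z \<Longrightarrow> A \<subseteq> V" and m: "0 < m" "m \<le> s" "s \<le> n"
    and sz: "\<And>A. A \<in> Z \<Longrightarrow> real (card A) * real s \<le> real n * real m / 4"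
    and num: "real (card Z) \<le> exp (real m / 6)"
  obtains M where "M \<subseteq> V" "card M = s" "\<And>A. A \<in> Z \<Longrightarrow> card (M \<inter> A) < m"
proof -
  define Bad where "Bad = (\<Union>A\<in>Z. \<Union>K\<in>{K. K \<subseteq> A \<and> card K = m}. {M. M \<subseteq> V \<and> card M = s \<and> K \<subseteq> M})"
  have "\<not> {M. M \<subseteq> V \<and> card M = s} \<subseteq> Bad"
  proof
    assume sb: "{M. M \<subseteq> V \<and> card M = s} \<subseteq> Bad"
    define q where "q = real ((n - m) choose (s - m))"
    have q: "q > 0" unfolding q_def using m by simp
    have fA: "finite A" if "A \<in> Z" for A using sub[OF that] fV finite_subset by blast
    have finK: "finite {K. K \<subseteq> A \<and> card K = m}" if "A \<in> Z" for A
      by (rule finite_subset[of _ "Pow A"]) (use fA that in auto)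
    have "finite Bad" by (rule finite_subset[of _ "Pow V"]) (use fV in \<open>auto simp: Bad_def\<close>)
    then have "card {M. M \<subseteq> V \<and> card M = s} \<le> card Bad" using sb by (rule card_mono)
    then have "real (n choose s) \<le> real (card Bad)"
      using n_subsets[OF fV, of s] nV by simp
    also have "\<dots> \<le> real (\<Sum>A\<in>Z. card (\<Union>K\<in>{K. K \<subseteq> A \<and> card K = m}. {M. M \<subseteq> V \<and> card M = s \<and> K \<subseteq> M}))"
      unfolding Bad_def of_nat_le_iff by (rule card_UN_le[OF fZ])
    also have "\<dots> \<le> (\<Sum>A\<in>Z. real (card A choose m) * q)"
      unfolding of_nat_sum
    proof (rule sum_mono)
      fix A assume A: "A \<in> Z"
      have "card (\<Union>K\<in>{K. K \<subseteq> A \<and> card K = m}. {M. M \<subseteq> V \<and> card M = s \<and> K \<subseteq> M})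
          \<le> (\<Sum>K\<in>{K. K \<subseteq> A \<and> card K = m}. card {M. M \<subseteq> V \<and> card M = s \<and> K \<subseteq> M})"
        by (rule card_UN_le[OF finK[OF A]])
      also have "\<dots> = (\<Sum>K\<in>{K. K \<subseteq> A \<and> card K = m}. (n - m) choose (s - m))"
      proof (rule sum.cong[OF refl])
        fix K assume "K \<in> {K. K \<subseteq> A \<and> card K = m}"
        then show "card {M. M \<subseteq> V \<and> card M = s \<and> K \<subseteq> M} = (n - m) choose (s - m)"
          using card_supersets[OF fV, of K s] sub[OF A] m nV by auto
      qed
      also have "\<dots> = (card A choose m) * ((n - m) choose (s - m))"
        using n_subsets[OF fA[OF A], of m] by simp
      finally show "real (card (\<Union>K\<in>{K. K \<subseteq> A \<and> card K = m}. {M. M \<subseteq> V \<and> card M = s \<and> K \<subseteq> M}))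
          \<le> real (card A choose m) * q"
        unfolding q_def by (simp only: of_nat_mult[symmetric] of_nat_le_iff)
    qed
    finally have 1: "real (n choose s) \<le> (\<Sum>A\<in>Z. real (card A choose m) * q)" .
    define Q where "Q = real (s choose m)"
    have Q: "Q > 0" unfolding Q_def using m by simp
    have C: "real (n choose m) > 0" using m by simp
    \<comment> \<open>Both sides count pairs of an \<open>m\<close>-set inside an
      \<open>s\<close>-set. The identity lets \<open>q\<close>, the number of \<open>s\<close>-sets
      over a fixed \<open>m\<close>-set, cancel from the union bound.\<close>
    have "real (n choose s) * Q = real (n choose m) * q"
      unfolding Q_def q_def using choose_mult[of m s n] m by (simp flip: of_nat_mult)
    then have "real (n choose m) * q \<le> (\<Sum>A\<in>Z. real (card A choose m) * q) * Q"
      using mult_right_mono[OF 1, of Q] Q by simp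
    also have "\<dots> = (\<Sum>A\<in>Z. real (card A choose m) * Q) * q"
      by (simp add: sum_distrib_left sum_distrib_right mult_ac)
    finally have "real (n choose m) \<le> (\<Sum>A\<in>Z. real (card A choose m) * Q)"
      using q by simp
    also have "\<dots> \<le> (\<Sum>A\<in>Z. real (n choose m) * (exp 1 / 4) ^ m)"
    proof (rule sum_mono)
      fix A assume A: "A \<in> Z"
      have f: "real (card A choose m) * fact m \<le> real (card A) ^ m"
        using of_nat_mono[OF binomial_fact_pow[of "card A" m], where 'a = real] by simp
      \<comment> \<open>The quotient of \<open>m ^ m\<close> by \<open>fact m\<close> is a single
        term of the series for \<open>exp m\<close>.\<close>
      have e: "real m ^ m \<le> exp 1 ^ m * fact m"
      proof -
        have "(\<Sum>k\<in>{m}. real m ^ k /\<^sub>R fact k) \<le> exp (real m)"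
          unfolding exp_def by (rule sum_le_suminf[OF summable_exp_generic]) auto
        then show ?thesis by (simp add: field_simps exp_of_nat_mult[symmetric])
      qed
      have "(real (card A choose m) * Q) * (real n ^ m * fact m)
        = (real (card A choose m) * fact m) * (Q * real n ^ m)" by simp
      also have "\<dots> \<le> real (card A) ^ m * (real s ^ m * real (n choose m))"
        unfolding Q_def by (rule mult_mono) (use f binomial_ratio_le[of s n m] m nV in auto)
      also have "\<dots> = (real (card A) * real s) ^ m * real (n choose m)"
        by (simp add: power_mult_distrib)
      also have "\<dots> \<le> (real n * real m / 4) ^ m * real (n choose m)"
        using sz[OF A] by (intro mult_right_mono power_mono) auto
      also have "\<dots> = real m ^ m * (real n ^ m * real (n choose m) / 4 ^ m)"
        by (simp add: power_mult_distrib power_divide)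
      also have "\<dots> \<le> (exp 1 ^ m * fact m) * (real n ^ m * real (n choose m) / 4 ^ m)"
        using e by (intro mult_right_mono) auto
      also have "\<dots> = (real (n choose m) * (exp 1 / 4) ^ m) * (real n ^ m * fact m)"
        by (simp add: power_divide)
      finally show "real (card A choose m) * Q \<le> real (n choose m) * (exp 1 / 4) ^ m"
        by (rule mult_right_le_imp_le) (use nV in simp)
    qed
    also have "\<dots> = real (n choose m) * (real (card Z) * (exp 1 / 4) ^ m)" by simp
    finally have "1 \<le> real (card Z) * (exp 1 / 4) ^ m" using C by simp
    also have "\<dots> \<le> exp (real m / 6) * (exp 1 / 4) ^ m"
      using num by (intro mult_right_mono) auto
    also have "exp (real m / 6) = exp (1 / 6) ^ m" by (simp flip: exp_of_nat_mult)
    also have "exp (1 / 6 :: real) ^ m * (exp 1 / 4) ^ m = (exp (1 / 6) * (exp 1 / 4)) ^ m"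
      by (rule power_mult_distrib[symmetric])
    also have "\<dots> < 1 ^ m"
    proof (rule power_strict_mono)
      \<comment> \<open>Sixth powers reduce \<open>exp (7/6) < 4\<close> to
        \<open>3 ^ 7 = 2187 < 4096 = 4 ^ 6\<close>.\<close>
      have "exp (1/6) * exp 1 = exp (7/6 :: real)" by (simp flip: exp_add)
      moreover have "exp (7/6 :: real) ^ 6 = exp 1 ^ 7" by (simp flip: exp_of_nat_mult)
      moreover have "exp 1 ^ 7 \<le> (3 :: real) ^ 7" using exp_le by (intro power_mono) auto
      ultimately have "(exp (1/6) * exp 1) ^ 6 < (4 :: real) ^ 6" by simp
      then have "exp (1/6) * exp 1 < (4 :: real)" by (rule power_less_imp_less_base) simp
      then show "exp (1/6) * (exp 1 / 4) < (1 :: real)" by simp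
    qed (use m in auto)
    finally show False by simp
  qed
  then obtain M where M: "M \<subseteq> V" "card M = s" "M \<notin> Bad" by blast
  show thesis
  proof (rule that[OF M(1,2)])
    fix A assume A: "A \<in> Z"
    show "card (M \<inter> A) < m"
    proof (rule ccontr)
      assume "\<not> ?thesis"
      then obtain K where "K \<subseteq> M \<inter> A" "card K = m"
        by (metis not_less obtain_subset_with_card_n)
      then show False using M A unfolding Bad_def by blast
    qed
  qed
qed

section \<open>Expansion and coloured embeddings\<close>

text \<open>Elements of \<open>X\<close> may belong to it. This makes it the union of the
  neighbourhoods of single vertices, as Hall-type arguments require.\<close>

definition nbhd :: "'a graph \<Rightarrow> 'a set \<Rightarrow> 'a set" where
  "nbhd H X = {y. \<exists>x\<in>X. {x, y} \<in> edges H}"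

lemma weak_expander_nbhd:
  assumes "weak_expander H a b" "X \<subseteq> verts H" "Y \<subseteq> verts H" "X \<inter> Y = {}"
    "a \<le> card X" "b \<le> card Y"
  shows "Y \<inter> nbhd H X \<noteq> {}"
proof -
  obtain X0 where X0: "X0 \<subseteq> X" "card X0 = a" using assms(5) by (meson obtain_subset_with_card_n)
  obtain Y0 where Y0: "Y0 \<subseteq> Y" "card Y0 = b" using assms(6) by (meson obtain_subset_with_card_n)
  have "X0 \<subseteq> verts H \<and> Y0 \<subseteq> verts H \<and> X0 \<inter> Y0 = {} \<and> card X0 = a \<and> card Y0 = b"
    using assms(2-4) X0 Y0 by blast
  then have "edges_between H X0 Y0 > 0"
    using assms(1) unfolding weak_expander_def by (elim allE impE)
  then have "{e \<in> edges H. \<exists>x\<in>X0. \<exists>y\<in>Y0. e = {x, y}} \<noteq> {}"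
    unfolding edges_between_def card_gt_0_iff by (rule conjunct1)
  then obtain x y where "x \<in> X0" "y \<in> Y0" "{x, y} \<in> edges H" by blast
  then have "y \<in> Y \<inter> nbhd H X" using X0 Y0 by (auto simp: nbhd_def)
  then show ?thesis by blast
qed

text \<open>For \<open>m\<close> elements \<open>X0\<close> of \<open>X\<close>, fewer than
  \<open>m\<close> vertices of \<open>S\<close> outside \<open>X0\<close> miss the neighbourhood of
  \<open>X0\<close>, and at most \<open>m\<close> further ones lie in \<open>X0\<close>
  itself.\<close>

lemma weak_expander_large:
  assumes fin: "finite (verts H)" and exp: "weak_expander H m m" and X: "X \<subseteq> verts H" "m \<le> card X"
    and S: "S \<subseteq> verts H"
  shows "card S < card (S \<inter> nbhd H X) + 2 * m"
proof -
  obtain X0 where X0: "X0 \<subseteq> X" "card X0 = m" using X(2) by (meson obtain_subset_with_card_n)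
  have fS: "finite S" "finite X0" using fin S X X0 by (meson finite_subset)+
  have "card (S - X0 - nbhd H X0) < m"
  proof (rule ccontr)
    assume "\<not> ?thesis"
    then have "(S - X0 - nbhd H X0) \<inter> nbhd H X0 \<noteq> {}"
      using X0 X S by (intro weak_expander_nbhd[OF exp]) auto
    then show False by blast
  qed
  moreover have "card S \<le> card ((S \<inter> nbhd H X) \<union> (X0 \<union> (S - X0 - nbhd H X0)))"
    using fS X0 by (intro card_mono) (auto simp: nbhd_def)
  moreover have "card ((S \<inter> nbhd H X) \<union> (X0 \<union> (S - X0 - nbhd H X0)))
      \<le> card (S \<inter> nbhd H X) + card (X0 \<union> (S - X0 - nbhd H X0))" by (rule card_Un_le)
  moreover have "card (X0 \<union> (S - X0 - nbhd H X0)) \<le> card X0 + card (S - X0 - nbhd H X0)"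
    by (rule card_Un_le)
  ultimately show ?thesis using X0 by linarith
qed

text \<open>
  The deleted set is a largest union of one badly expanding set per colour; such sets stay smaller
  than \<open>m\<close> because sets of size at least \<open>m\<close> expand.
\<close>

lemma expanding_core:
  fixes \<kappa> :: "'a \<Rightarrow> bool"
  assumes fin: "finite (verts H)" and exp: "weak_expander H m m"
    and big: "\<And>c. 2 * m * D + 6 * m \<le> card {x \<in> verts H. \<kappa> x = c}"
  obtains U where "U \<subseteq> verts H" "card (verts H - U) \<le> 2 * m"
    "\<And>X c. X \<subseteq> U \<Longrightarrow> X \<noteq> {} \<Longrightarrow> card X \<le> 2 * m \<Longrightarrow>
      D * card X < card {y \<in> U. \<kappa> y = c \<and> y \<in> nbhd H X}"
proof -
  let ?V = "verts H"
  define B where "B \<beta> = \<beta> True \<union> \<beta> False" for \<beta> :: "bool \<Rightarrow> 'a set"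
  \<comment> \<open>The size bound \<open>2 * m\<close> leaves room for joining two sets of size
    below \<open>m\<close>, as the maximality argument does.\<close>
  define bad where "bad \<beta> \<longleftrightarrow> (\<forall>c. \<beta> c \<subseteq> ?V \<and> card (\<beta> c) \<le> 2 * m \<and>
    card {y \<in> ?V - B \<beta>. \<kappa> y = c \<and> y \<in> nbhd H (\<beta> c)} \<le> D * card (\<beta> c))" for \<beta>
  have Bc: "\<beta> c \<subseteq> B \<beta>" for \<beta> c by (cases c) (auto simp: B_def)
  have cB: "card (B \<beta>) \<le> card (\<beta> True) + card (\<beta> False)" for \<beta>
    unfolding B_def by (rule card_Un_le)
  have target: "2 * m * D + 4 * m < card {y \<in> ?V - B \<beta>. \<kappa> y = c \<and> y \<in> nbhd H X} + card (B \<beta>)"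
    if X: "X \<subseteq> ?V" "m \<le> card X" and B: "B \<beta> \<subseteq> ?V" for X \<beta> c
  proof -
    let ?S = "{x \<in> ?V. \<kappa> x = c}"
    have "card ?S < card (?S \<inter> nbhd H X) + 2 * m"
      by (rule weak_expander_large[OF fin exp X]) auto
    moreover have "card (?S \<inter> nbhd H X) \<le> card ({y \<in> ?V - B \<beta>. \<kappa> y = c \<and> y \<in> nbhd H X} \<union> B \<beta>)"
      using fin B finite_subset by (intro card_mono) auto
    moreover have "\<dots> \<le> card {y \<in> ?V - B \<beta>. \<kappa> y = c \<and> y \<in> nbhd H X} + card (B \<beta>)"
      by (rule card_Un_le)
    ultimately show ?thesis using big[of c] by linarith
  qed
  have BV: "B \<beta> \<subseteq> ?V" if "bad \<beta>" for \<beta> using that by (auto simp: bad_def B_def)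
  \<comment> \<open>Bootstrapping: a priori \<open>B \<beta>\<close> has at most
    \<open>4 * m\<close> elements, so by \<open>target\<close> a set of size at least
    \<open>m\<close> keeps more than \<open>2 * m * D\<close> neighbours and cannot be bad.\<close>
  have small: "card (\<beta> c) < m" if \<beta>: "bad \<beta>" for \<beta> c
  proof (rule ccontr)
    assume "\<not> ?thesis"
    then have "2 * m * D + 4 * m < card {y \<in> ?V - B \<beta>. \<kappa> y = c \<and> y \<in> nbhd H (\<beta> c)} + card (B \<beta>)"
      using \<beta> BV[OF \<beta>] by (intro target) (auto simp: bad_def)
    moreover have "card {y \<in> ?V - B \<beta>. \<kappa> y = c \<and> y \<in> nbhd H (\<beta> c)} \<le> D * card (\<beta> c)"
      using \<beta> unfolding bad_def by blast
    moreover have "D * card (\<beta> c) \<le> D * (2 * m)"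
      using \<beta> unfolding bad_def by (intro mult_le_mono2) blast
    moreover have "card (\<beta> True) \<le> 2 * m" "card (\<beta> False) \<le> 2 * m"
      using \<beta> unfolding bad_def by blast+
    ultimately show False using cB[of \<beta>] by (simp add: algebra_simps)
  qed
  have "bad (\<lambda>_. {})" by (simp add: bad_def nbhd_def)
  moreover have "\<forall>\<beta>. bad \<beta> \<longrightarrow> card (\<beta> True) + card (\<beta> False) < 2 * m"
    using small by (metis add_strict_mono mult_2)
  ultimately obtain \<beta> where \<beta>: "bad \<beta>"
    and max: "\<forall>\<gamma>. bad \<gamma> \<longrightarrow> card (\<gamma> True) + card (\<gamma> False) \<le> card (\<beta> True) + card (\<beta> False)"
    using ex_has_greatest_nat[of bad "\<lambda>_. {}" "\<lambda>\<beta>. card (\<beta> True) + card (\<beta> False)" "2 * m"] by blast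
  have cB2: "card (B \<beta>) \<le> 2 * m"
    using small[OF \<beta>, of True] small[OF \<beta>, of False] cB[of \<beta>] by linarith
  show thesis
  proof (rule that[of "?V - B \<beta>"])
    have "?V - (?V - B \<beta>) = B \<beta>" using BV[OF \<beta>] by blast
    then show "card (?V - (?V - B \<beta>)) \<le> 2 * m" using cB2 by simp
  next
    fix X c assume X: "X \<subseteq> ?V - B \<beta>" "X \<noteq> {}" "card X \<le> 2 * m"
    have fX: "finite X" using X(1) fin by (meson finite_Diff finite_subset)
    show "D * card X < card {y \<in> ?V - B \<beta>. \<kappa> y = c \<and> y \<in> nbhd H X}" (is "_ < card ?T")
    proof (cases "m \<le> card X")
      case True
      have "2 * m * D + 4 * m < card ?T + card (B \<beta>)"
        by (rule target) (use X True BV[OF \<beta>] in auto)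
      moreover have "D * card X \<le> 2 * m * D"
        using mult_le_mono2[OF X(3), of D] by (simp add: mult_ac)
      ultimately show ?thesis using cB2 by linarith
    next
      case False
      show ?thesis
      proof (rule ccontr)
        assume *: "\<not> ?thesis"
        \<comment> \<open>A failing \<open>X\<close> can be merged into the set of colour
          \<open>c\<close>: neighbour counts outside the larger deleted set are subadditive for
          \<open>c\<close> and can only fall for the other colour. This contradicts
          maximality.\<close>
        define \<gamma> where "\<gamma> = \<beta>(c := \<beta> c \<union> X)"
        have B\<gamma>: "B \<gamma> = B \<beta> \<union> X" by (cases c) (auto simp: \<gamma>_def B_def)
        have f\<beta>: "finite (\<beta> c)" for c using \<beta> fin by (meson bad_def finite_subset)
        have card\<gamma>: "card (\<gamma> c) = card (\<beta> c) + card X"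
          unfolding \<gamma>_def using Bc[of \<beta> c] X f\<beta> fX by (simp, intro card_Un_disjoint) auto
        have "bad \<gamma>"
          unfolding bad_def
        proof (intro allI conjI)
          fix c'
          let ?N = "\<lambda>\<beta>. {y \<in> ?V - B \<beta>. \<kappa> y = c' \<and> y \<in> nbhd H (\<beta> c')}"
          show "\<gamma> c' \<subseteq> ?V" using \<beta> X unfolding \<gamma>_def bad_def by auto
          have c1: "\<gamma> c' = \<beta> c'" if "c' \<noteq> c" using that by (simp add: \<gamma>_def)
          show "card (\<gamma> c') \<le> 2 * m"
          proof (cases "c' = c")
            case True
            then show ?thesis using card\<gamma> small[OF \<beta>, of c] False by simp
          next
            case False
            then show ?thesis using c1 small[OF \<beta>, of c'] by simp
          qed
          show "card (?N \<gamma>) \<le> D * card (\<gamma> c')"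
          proof (cases "c' = c")
            case True
            have "card (?N \<gamma>) \<le> card (?N \<beta> \<union> ?T)"
              using fin True unfolding B\<gamma> by (intro card_mono) (auto simp: \<gamma>_def nbhd_def)
            also have "\<dots> \<le> card (?N \<beta>) + card ?T" by (rule card_Un_le)
            also have "card (?N \<beta>) \<le> D * card (\<beta> c')" using \<beta> unfolding bad_def by blast
            also have "card ?T \<le> D * card X" using * by simp
            finally show ?thesis using True card\<gamma> by (simp add: algebra_simps)
          next
            case False
            have "card (?N \<gamma>) \<le> card (?N \<beta>)"
              using fin unfolding B\<gamma> c1[OF False] by (intro card_mono) auto
            also have "\<dots> \<le> D * card (\<beta> c')" using \<beta> unfolding bad_def by blast
            finally show ?thesis using c1[OF False] by simp
          qed
        qed
        then have "card (\<gamma> True) + card (\<gamma> False) \<le> card (\<beta> True) + card (\<beta> False)"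
          using max by blast
        moreover have "card X > 0" using X fX by (simp add: card_gt_0_iff)
        ultimately show False using card\<gamma> by (cases c) (auto simp: \<gamma>_def)
      qed
    qed
  qed auto
qed

text \<open>
  The function \<open>d\<close> records how many further neighbours of each colour every vertex must still be able
  to provide.
\<close>

lemma coloured_tree_embedding:
  fixes H :: "'a graph" and \<kappa> :: "'a \<Rightarrow> 'c" and col :: "'b \<Rightarrow> 'c"
    and rank :: "'b \<Rightarrow> nat"
  assumes fU: "finite U" and fV: "finite V" and r: "r \<in> A" and AV: "A \<subseteq> V"
    and par: "\<And>v. v \<in> V - {r} \<Longrightarrow> rank (par v) < rank v"
    and closed: "\<And>v. v \<in> A - {r} \<Longrightarrow> par v \<in> A"
    and deg: "\<And>s. s \<in> V \<Longrightarrow> card {t \<in> V - {r}. par t = s} \<le> D"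
    and inhabited: "\<And>c. \<exists>y\<in>U. \<kappa> y = c"
    and expand: "\<And>X c. X \<subseteq> U \<Longrightarrow> X \<noteq> {} \<Longrightarrow> card X \<le> 2 * m \<Longrightarrow>
      D * card X < card {y \<in> U. \<kappa> y = c \<and> y \<in> nbhd H X}"
    and large: "\<And>X c. X \<subseteq> U \<Longrightarrow> m \<le> card X \<Longrightarrow> card X \<le> 2 * m \<Longrightarrow>
      card {t \<in> A. col t = c} + 2 * m * D < card {y \<in> U. \<kappa> y = c \<and> y \<in> nbhd H X}"
  shows "\<exists>f d. inj_on f A \<and> f ` A \<subseteq> U \<and> (\<forall>t\<in>A. \<kappa> (f t) = col t) \<and>
    (\<forall>t\<in>A - {r}. {f (par t), f t} \<in> edges H) \<and>
    (\<forall>c x. d c x \<le> D) \<and> (\<forall>c. \<forall>x\<in>U - f ` A. d c x = D) \<and>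
    (\<forall>c. \<forall>s\<in>A. card {t \<in> V - A. par t = s \<and> col t = c} \<le> d c (f s)) \<and>
    (\<forall>X c. X \<subseteq> U \<longrightarrow> card X \<le> 2 * m \<longrightarrow>
      sum (d c) X \<le> card ({y \<in> U. \<kappa> y = c \<and> y \<in> nbhd H X} - f ` A))"
  using r AV closed large
proof (induction "card A" arbitrary: A)
  case 0
  then show ?case using finite_subset[OF _ fV] by auto
next
  case (Suc n)
  have fA: "finite A" using Suc.prems finite_subset[OF _ fV] by auto
  show ?case
  proof (cases "A = {r}")
    case True
    obtain y where y: "y \<in> U" "\<kappa> y = col r" using inhabited by blast
    have "sum (\<lambda>_. D) X \<le> card ({z \<in> U. \<kappa> z = c \<and> z \<in> nbhd H X} - {y})"
      if X: "X \<subseteq> U" "card X \<le> 2 * m" for X c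
    proof (cases "X = {}")
      case False
      \<comment> \<open>The strict inequality in \<open>expand\<close> pays for the one vertex
        \<open>y\<close> occupied by the root.\<close>
      have "D * card X < card {z \<in> U. \<kappa> z = c \<and> z \<in> nbhd H X}"
        using expand[OF X(1) False X(2)] .
      moreover have "card {z \<in> U. \<kappa> z = c \<and> z \<in> nbhd H X} - 1
          \<le> card ({z \<in> U. \<kappa> z = c \<and> z \<in> nbhd H X} - {y})"
        using fU by (simp add: card_Diff_singleton_if)
      ultimately show ?thesis by (simp add: mult.commute)
    qed simp
    moreover have "card {t \<in> V - {r}. par t = r \<and> col t = c} \<le> D" for c
    proof -
      have "card {t \<in> V - {r}. par t = r \<and> col t = c} \<le> card {t \<in> V - {r}. par t = r}"
        using fV by (intro card_mono) auto
      then show ?thesis using deg[of r] Suc.prems by fastforce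
    qed
    ultimately show ?thesis using y True
      by (intro exI[of _ "\<lambda>_. y"] exI[of _ "\<lambda>_ _. D"]) auto
  next
    case False
    \<comment> \<open>A vertex of largest rank has no child in \<open>A\<close>, so removing it
      leaves a set closed under parents.\<close>
    have "\<forall>y. y \<in> A - {r} \<longrightarrow> rank y < Suc (Max (rank ` A))"
      using fA by (auto simp: less_Suc_eq_le)
    moreover obtain t0 where "t0 \<in> A - {r}" using False Suc.prems(1) by blast
    ultimately obtain t where t: "t \<in> A - {r}" and tmax: "\<And>v. v \<in> A - {r} \<Longrightarrow> rank v \<le> rank t"
      using ex_has_greatest_nat[of "\<lambda>v. v \<in> A - {r}" t0 rank] by blast
    define B where "B = A - {t}"
    have A: "A = insert t B" "t \<notin> B" "t \<noteq> r" "t \<in> V" "r \<in> B" "B \<subseteq> V" "finite B"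
      using t Suc.prems fA by (auto simp: B_def)
    have closedB: "par v \<in> B" if v: "v \<in> B - {r}" for v
    proof -
      have "par v \<in> A" using Suc.prems(3) v A by auto
      moreover have "rank (par v) < rank v" using par[of v] v A by auto
      moreover have "rank v \<le> rank t" using tmax v A by auto
      ultimately show ?thesis by (auto simp: B_def)
    qed
    have "par t \<in> A" using Suc.prems(3)[OF t] .
    moreover have "par t \<noteq> t" using par[of t] A by auto
    ultimately have pB: "par t \<in> B" by (simp add: B_def)
    have largeB: "card {t \<in> B. col t = c} + 2 * m * D < card {y \<in> U. \<kappa> y = c \<and> y \<in> nbhd H X}"
      if "X \<subseteq> U" "m \<le> card X" "card X \<le> 2 * m" for X c
    proof -
      have "card {t \<in> B. col t = c} \<le> card {t \<in> A. col t = c}"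
        using fA A by (intro card_mono) auto
      then show ?thesis using Suc.prems(4)[OF that, of c] by linarith
    qed
    have nB: "n = card B" using Suc.hyps(2) A by simp
    obtain f d where inj: "inj_on f B" and fB: "f ` B \<subseteq> U" and colf: "\<forall>t\<in>B. \<kappa> (f t) = col t"
      and edge: "\<forall>t\<in>B - {r}. {f (par t), f t} \<in> edges H"
      and dD: "\<forall>c x. d c x \<le> D" and dnew: "\<forall>c. \<forall>x\<in>U - f ` B. d c x = D"
      and dch: "\<forall>c. \<forall>s\<in>B. card {t \<in> V - B. par t = s \<and> col t = c} \<le> d c (f s)"
      and ext: "\<forall>X c. X \<subseteq> U \<longrightarrow> card X \<le> 2 * m \<longrightarrow>
        sum (d c) X \<le> card ({y \<in> U. \<kappa> y = c \<and> y \<in> nbhd H X} - f ` B)"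
      by (rule Suc.hyps(1)[OF nB A(5,6), THEN exE], erule closedB, erule (2) largeB)
        (elim exE conjE, (rule that; assumption))
    let ?c = "col t" and ?x = "f (par t)"
    define N where "N x = {y \<in> U. \<kappa> y = ?c \<and> {x, y} \<in> edges H} - f ` B" for x
    have UN: "\<Union>(N ` X) = {y \<in> U. \<kappa> y = ?c \<and> y \<in> nbhd H X} - f ` B" for X
      by (auto simp: N_def nbhd_def)
    have xU: "?x \<in> U" using pB fB by auto
    have m: "0 < m"
    proof (rule ccontr)
      assume "\<not> 0 < m"
      then show False using largeB[of "{}" ?c] by (simp add: nbhd_def)
    qed
    have "1 \<le> card {s \<in> V - B. par s = par t \<and> col s = ?c}"
      using A fV by (auto simp: Suc_le_eq card_gt_0_iff)
    also have "\<dots> \<le> d ?c ?x" using dch pB by blast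
    finally have dx: "1 \<le> d ?c ?x" .
    \<comment> \<open>By \<open>largeB\<close>, a set of at least \<open>m\<close> vertices has so
      many neighbours of this colour that, after discarding the images of \<open>B\<close>, more
      than \<open>2 * m * D\<close> remain. The total demand is at most \<open>2 * m * D\<close>, so
      such a set is not tight.\<close>
    have tight: "2 * card X < 2 * m"
      if X: "X \<subseteq> U" "card X \<le> 2 * m" "card (\<Union>(N ` X)) = sum (d ?c) X" for X
    proof (rule ccontr)
      assume "\<not> ?thesis"
      then have "m \<le> card X" by simp
      then have 1: "card {s \<in> B. col s = ?c} + 2 * m * D < card {y \<in> U. \<kappa> y = ?c \<and> y \<in> nbhd H X}"
        using largeB X by blast
      have "{y \<in> U. \<kappa> y = ?c \<and> y \<in> nbhd H X} \<subseteq> \<Union>(N ` X) \<union> f ` {s \<in> B. col s = ?c}"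
        unfolding UN using colf by auto
      then have "card {y \<in> U. \<kappa> y = ?c \<and> y \<in> nbhd H X} \<le> card (\<Union>(N ` X) \<union> f ` {s \<in> B. col s = ?c})"
        using fU A(7) by (intro card_mono) (auto simp: UN)
      also have "\<dots> \<le> card (\<Union>(N ` X)) + card (f ` {s \<in> B. col s = ?c})" by (rule card_Un_le)
      also have "card (f ` {s \<in> B. col s = ?c}) \<le> card {s \<in> B. col s = ?c}"
        using A(7) by (intro card_image_le) auto
      also have "card (\<Union>(N ` X)) \<le> 2 * m * D"
      proof -
        have "sum (d ?c) X \<le> card X * D" using sum_bounded_above[of X "d ?c" D] dD by simp
        also have "\<dots> \<le> 2 * m * D" using X by simp
        finally show ?thesis using X by simp
      qed
      finally show False using 1 by linarith
    qed
    obtain y where y: "y \<in> N ?x" and ystep: "\<And>X. X \<subseteq> U \<Longrightarrow> card X \<le> 2 * m \<Longrightarrow>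
        sum ((d ?c)(?x := d ?c ?x - 1)) X \<le> card (\<Union>(N ` X) - {y})"
    proof (rule demand_step[of U N "2 * m" "d ?c" ?x])
      show "finite (N x)" for x using fU by (simp add: N_def)
      show "sum (d ?c) X \<le> card (\<Union>(N ` X))" if "X \<subseteq> U" "card X \<le> 2 * m" for X
        unfolding UN using ext that by blast
    qed (use fU xU dx tight in blast)+
    have yU: "y \<in> U" "\<kappa> y = ?c" "{?x, y} \<in> edges H" "y \<notin> f ` B" using y by (auto simp: N_def)
    define g where "g = f(t := y)"
    define e where "e = d(?c := (d ?c)(?x := d ?c ?x - 1))"
    have gB: "g s = f s" if "s \<in> B" for s using that A(2) by (auto simp: g_def)
    have gt: "g t = y" by (simp add: g_def)
    have gim: "g ` A = insert y (f ` B)" using A(1) gB gt by auto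
    have ed: "e c x \<le> d c x" for c x by (auto simp: e_def)
    have "inj_on g A"
      using inj yU(4) A(1,2) gB gt unfolding inj_on_def by (metis imageI insertE)
    moreover have "g ` A \<subseteq> U" using gim fB yU by auto
    moreover have "\<forall>s\<in>A. \<kappa> (g s) = col s" using A(1) gB gt colf yU by auto
    moreover have "\<forall>s\<in>A - {r}. {g (par s), g s} \<in> edges H"
    proof
      fix s assume s: "s \<in> A - {r}"
      show "{g (par s), g s} \<in> edges H"
      proof (cases "s = t")
        case True
        then show ?thesis using gt gB[OF pB] yU by simp
      next
        case False
        then have "s \<in> B - {r}" using s A by auto
        then show ?thesis using gB closedB edge by auto
      qed
    qed
    moreover have "\<forall>c x. e c x \<le> D" using ed dD by (meson order_trans)
    moreover have "\<forall>c. \<forall>x\<in>U - g ` A. e c x = D"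
      using dnew pB by (auto simp: gim e_def)
    moreover have "\<forall>c. \<forall>s\<in>A. card {u \<in> V - A. par u = s \<and> col u = c} \<le> e c (g s)"
    proof (intro allI ballI)
      fix c s assume s: "s \<in> A"
      show "card {u \<in> V - A. par u = s \<and> col u = c} \<le> e c (g s)"
      proof (cases "s = t")
        case True
        have "card {u \<in> V - A. par u = s \<and> col u = c} \<le> card {u \<in> V - {r}. par u = s}"
          using fV Suc.prems(1) by (intro card_mono) auto
        also have "\<dots> \<le> D" using deg True A by auto
        also have "D = d c y" using dnew yU by auto
        also have "\<dots> = e c y" using yU pB by (auto simp: e_def)
        finally show ?thesis using True gt by simp
      next
        case False
        then have sB: "s \<in> B" using s A by auto
        have fin: "finite {u \<in> V - B. par u = s \<and> col u = c}" using fV by simp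
        show ?thesis
        proof (cases "c = ?c \<and> s = par t")
          case True
          have "{u \<in> V - A. par u = s \<and> col u = c} = {u \<in> V - B. par u = s \<and> col u = c} - {t}"
            using A(1) by auto
          moreover have "t \<in> {u \<in> V - B. par u = s \<and> col u = c}" using True A by auto
          ultimately have "card {u \<in> V - A. par u = s \<and> col u = c}
              = card {u \<in> V - B. par u = s \<and> col u = c} - 1"
            using fin by simp
          also have "\<dots> \<le> d c (f s) - 1" using dch sB by (intro diff_le_mono) blast
          also have "\<dots> = e c (g s)" using True gB[OF sB] by (simp add: e_def)
          finally show ?thesis .
        next
          case F: False
          have "card {u \<in> V - A. par u = s \<and> col u = c} \<le> card {u \<in> V - B. par u = s \<and> col u = c}"
            using fin A(1) by (intro card_mono) auto
          also have "\<dots> \<le> d c (f s)" using dch sB by blast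
          also have "\<dots> = e c (g s)"
          proof -
            have "f s \<noteq> f (par t)" if "c = ?c" using F that inj sB pB by (auto dest: inj_onD)
            then show ?thesis using gB[OF sB] by (auto simp: e_def)
          qed
          finally show ?thesis .
        qed
      qed
    qed
    moreover have "\<forall>X c. X \<subseteq> U \<longrightarrow> card X \<le> 2 * m \<longrightarrow>
      sum (e c) X \<le> card ({z \<in> U. \<kappa> z = c \<and> z \<in> nbhd H X} - g ` A)"
    proof (intro allI impI)
      fix X c assume X: "X \<subseteq> U" "card X \<le> 2 * m"
      show "sum (e c) X \<le> card ({z \<in> U. \<kappa> z = c \<and> z \<in> nbhd H X} - g ` A)"
      proof (cases "c = ?c")
        case True
        then have "sum (e c) X \<le> card (\<Union>(N ` X) - {y})" using ystep[OF X] by (simp add: e_def)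
        moreover have "\<Union>(N ` X) - {y} = {z \<in> U. \<kappa> z = c \<and> z \<in> nbhd H X} - g ` A"
          unfolding UN gim using True by auto
        ultimately show ?thesis by simp
      next
        case False
        have "{z \<in> U. \<kappa> z = c \<and> z \<in> nbhd H X} - g ` A = {z \<in> U. \<kappa> z = c \<and> z \<in> nbhd H X} - f ` B"
          unfolding gim using False yU by auto
        moreover have "sum (e c) X = sum (d c) X" using False by (simp add: e_def)
        ultimately show ?thesis using ext X by simp
      qed
    qed
    ultimately show ?thesis by (intro exI[of _ g] exI[of _ e] conjI)
  qed
qed

section \<open>Embedding trees with many leaves\<close>

lemma embedding_with_many_leaves:
  fixes H :: "'a graph" and T :: "'b graph" and m :: nat
  assumes pos: "n > 0" "m > 0" "D > 0" and m1: "6 * real m1 * ln (real n) < real m" "m1 > 0"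
    and H: "simple_graph H" "card (verts H) = n"
    and exp1: "weak_expander H m1 (nat \<lceil>real n / (32 * real D)\<rceil>)"
    and exp2: "weak_expander H m m"
    and T: "T \<in> bounded_degree_trees (n - m1) D" and leavesT: "24 * D * m \<le> card (leaves T)"
  shows "contains_copy H T"
proof -
  let ?V = "verts H" and ?W = "verts T"

  \<comment> \<open>Rooting the tree and separating its leaves\<close>
  define q where "q = D * m"
  have q: "m \<le> q" "1 \<le> q" using pos by (auto simp: q_def)
  have fV: "finite ?V" using H by (simp add: simple_graph_def)
  have tree: "is_tree T" and cE: "card (edges T) = n - m1" and maxdeg: "\<And>v. v \<in> ?W \<Longrightarrow> degree T v \<le> D"
    using T by (auto simp: bounded_degree_trees_def)
  have sT: "simple_graph T" "?W \<noteq> {}" using tree by (auto simp: is_tree_def connected_graph_def)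
  then have fW: "finite ?W" by (simp add: simple_graph_def)
  obtain r where r: "r \<in> ?W" using sT by blast
  obtain par rank where par: "\<And>v. v \<in> ?W - {r} \<Longrightarrow> par v \<in> ?W \<and> rank (par v) < (rank v :: nat)"
    and ET: "edges T = (\<lambda>v. {v, par v}) ` (?W - {r})"
    using tree_parent[OF tree r] by metis
  have cW: "card ?W = Suc (n - m1)" using card_tree_edges[where r = r and par = par and rank = rank, OF fW r ET par] cE by simp
  \<comment> \<open>Excluding the root gives every vertex of \<open>L\<close> a parent, at the cost
    of at most one leaf; hence \<open>24 * q - 1\<close> below.\<close>
  define L where "L = leaves T - {r}"
  define A where "A = ?W - L"
  have LW: "L \<subseteq> ?W" "finite L" "leaves T \<subseteq> ?W" using fW finite_subset by (auto simp: L_def leaves_def)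
  have cL: "24 * q - 1 \<le> card L"
    using leavesT LW fW by (auto simp: L_def card_Diff_singleton_if q_def mult.assoc)
  have "24 * q \<le> card ?W" using leavesT card_mono[OF fW LW(3)] by (simp add: q_def mult.assoc)
  \<comment> \<open>As \<open>T\<close> has at least 24 vertices, the truncated difference
    \<open>n - m1\<close> is positive and hence genuine.\<close>
  then have nq: "24 * q \<le> n" "m1 < n" "card ?W + m1 = Suc n" using cW q m1 by linarith+
  have cA: "card A + card L = card ?W" using LW fW by (simp add: A_def card_Diff_subset card_mono)
  \<comment> \<open>The degree 1 of a vertex of \<open>L\<close> is used up by the edge to its own
    parent, so it has no child.\<close>
  have parA: "par v \<in> A" if v: "v \<in> ?W - {r}" for v
  proof -
    have "par v \<notin> L"
    proof
      assume pL: "par v \<in> L"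
      then have "degree T (par v) = 1" by (simp add: L_def leaves_def)
      moreover have "card {t \<in> ?W - {r}. par t = par v} < degree T (par v)"
        using child_count_le_degree(2)[where r = r and par = par and rank = rank, OF sT(1) ET par] pL LW by (auto simp: L_def)
      ultimately have "card {t \<in> ?W - {r}. par t = par v} = 0" by linarith
      then have "{t \<in> ?W - {r}. par t = par v} = {}" using fW by simp
      then show False using v by blast
    qed
    then show ?thesis using par[OF v] by (simp add: A_def)
  qed
  have rA: "r \<in> A" "A \<subseteq> ?W" "finite A" using r fW by (auto simp: A_def L_def)
  have LWr: "L \<subseteq> ?W - {r}" using LW by (auto simp: L_def)
  have deg: "card {t \<in> ?W - {r}. par t = s} \<le> D" if "s \<in> ?W" for s
    using child_count_le_degree(1)[where r = r and par = par and rank = rank, OF sT(1) ET par] maxdeg[OF that] by (meson order_trans)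

  \<comment> \<open>Each parent has at most \<open>D\<close> children, so fewer than
    \<open>2 * m\<close> parents would account for at most \<open>2 * q\<close> vertices of
    \<open>L\<close>.\<close>
  have "2 * m \<le> card (par ` L)"
  proof (rule ccontr)
    assume few: "\<not> ?thesis"
    have "card L \<le> card (\<Union>p\<in>par ` L. {t \<in> ?W - {r}. par t = p})"
      using LWr LW fW by (intro card_mono) auto
    also have "\<dots> \<le> (\<Sum>p\<in>par ` L. card {t \<in> ?W - {r}. par t = p})"
      using LW by (intro card_UN_le) auto
    also have "\<dots> \<le> card (par ` L) * D"
      using sum_bounded_above[of "par ` L" "\<lambda>p. card {t \<in> ?W - {r}. par t = p}" D] deg par LWr by fastforce
    also have "\<dots> \<le> (2 * m) * D" using few by (intro mult_le_mono1) simp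
    also have "\<dots> = 2 * q" by (simp add: q_def)
    finally show False using cL q by linarith
  qed
  then obtain P where P: "P \<subseteq> par ` L" "card P = 2 * m" by (meson obtain_subset_with_card_n)
  have PA: "P \<subseteq> A" using P parA LWr by blast
  have fP: "finite P" using PA rA finite_subset by blast

  \<comment> \<open>The reservoir\<close>
  define Z where "Z = (\<lambda>Y. ?V - Y - nbhd H Y) ` {Y. Y \<subseteq> ?V \<and> card Y = m1}"
  have fsub: "finite {Y. Y \<subseteq> ?V \<and> card Y = m1}"
    by (rule finite_subset[of _ "Pow ?V"]) (use fV in auto)
  obtain M where M: "M \<subseteq> ?V" "card M = 8 * q" and MZ: "\<And>B. B \<in> Z \<Longrightarrow> card (M \<inter> B) < m"
  proof (rule exists_reservoir[OF fV H(2) pos(1), of Z m "8 * q"])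
    show "finite Z" using fsub by (simp add: Z_def)
    show "B \<subseteq> ?V" if "B \<in> Z" for B using that by (auto simp: Z_def)
    show "0 < m" "m \<le> 8 * q" "8 * q \<le> n" using pos q nq by auto
    show "real (card B) * real (8 * q) \<le> real n * real m / 4" if B: "B \<in> Z" for B
    proof -
      obtain Y where Y: "Y \<subseteq> ?V" "card Y = m1" "B = ?V - Y - nbhd H Y" using B by (auto simp: Z_def)
      \<comment> \<open>No edge joins \<open>B\<close> to the \<open>m1\<close>-set
        \<open>Y\<close>, so the first expansion property bounds \<open>card B\<close> by
        \<open>n / (32 * D)\<close>. Times the reservoir size \<open>8 * D * m\<close> this is
        exactly \<open>n * m / 4\<close>.\<close>
      have "card B < nat \<lceil>real n / (32 * real D)\<rceil>"
      proof (rule ccontr)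
        assume "\<not> ?thesis"
        then have "nat \<lceil>real n / (32 * real D)\<rceil> \<le> card B" by (simp only: not_less)
        from weak_expander_nbhd[OF exp1 Y(1) _ _ _ this] have "B \<inter> nbhd H Y \<noteq> {}"
          using Y by auto
        then show False using Y by blast
      qed
      then have "real (card B) \<le> real n / (32 * real D)" by linarith
      then have "real (card B) * real (8 * q) \<le> real n / (32 * real D) * real (8 * q)"
        by (rule mult_right_mono) simp
      also have "\<dots> = real n * real m / 4" using pos by (simp add: q_def)
      finally show ?thesis .
    qed
    show "real (card Z) \<le> exp (real m / 6)"
    proof -
      have "card Z \<le> n choose m1"
        using card_image_le[OF fsub] n_subsets[OF fV, of m1] H by (simp add: Z_def)
      also have "\<dots> \<le> n ^ m1" using nq by (intro binomial_le_pow) simp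
      finally have "real (card Z) \<le> real n ^ m1" by (metis of_nat_le_iff of_nat_power)
      also have "\<dots> = exp (real m1 * ln (real n))" using pos by (simp add: exp_of_nat_mult)
      also have "\<dots> \<le> exp (real m / 6)" using m1 by simp
      finally show ?thesis .
    qed
  qed blast

  \<comment> \<open>Colour classes and the coloured embedding of the tree without
    \<open>L\<close>\<close>
  define \<kappa> where "\<kappa> x \<longleftrightarrow> x \<in> M" for x
  have "{x \<in> ?V. \<kappa> x = True} = M" "{x \<in> ?V. \<kappa> x = False} = ?V - M" using M by (auto simp: \<kappa>_def)
  moreover have "card (?V - M) = n - 8 * q" using M H fV finite_subset by (metis card_Diff_subset)
  ultimately have sizes: "card {x \<in> ?V. \<kappa> x = c} = (if c then 8 * q else n - 8 * q)" for c
    using M by (cases c) auto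
  have "2 * m * D + 6 * m \<le> card {x \<in> ?V. \<kappa> x = c}" for c
  proof -
    \<comment> \<open>The reservoir size \<open>8 * q\<close> is chosen to cover
      \<open>2 * q + 6 * m\<close>, using \<open>m \<le> q\<close>.\<close>
    have "2 * m * D = 2 * q" by (simp add: q_def)
    then have "2 * m * D + 6 * m \<le> 8 * q" "8 * q \<le> n - 8 * q" using q nq by linarith+
    then show ?thesis unfolding sizes by auto
  qed
  then obtain U where U: "U \<subseteq> ?V" "card (?V - U) \<le> 2 * m"
    and expand: "\<And>X c. X \<subseteq> U \<Longrightarrow> X \<noteq> {} \<Longrightarrow> card X \<le> 2 * m \<Longrightarrow>
      D * card X < card {y \<in> U. \<kappa> y = c \<and> y \<in> nbhd H X}"
    using expanding_core[OF fV exp2, of D \<kappa>] by blast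
  \<comment> \<open>Vertices of \<open>L\<close> get colour \<open>False\<close>, so the demand
    \<open>d False\<close> at the image of a parent reserves neighbours outside \<open>M\<close> for
    its leaves.\<close>
  define col where "col t \<longleftrightarrow> t \<in> P" for t
  have "{t \<in> A. col t = True} = P" "{t \<in> A. col t = False} = A - P" using PA by (auto simp: col_def)
  moreover have "card (A - P) = card A - 2 * m" using PA fP P by (simp add: card_Diff_subset)
  ultimately have colour: "card {t \<in> A. col t = c} = (if c then 2 * m else card A - 2 * m)" for c
    using P by (cases c) auto
  have large: "card {t \<in> A. col t = c} + 2 * m * D < card {y \<in> U. \<kappa> y = c \<and> y \<in> nbhd H X}"
    if X: "X \<subseteq> U" "m \<le> card X" for X c
  proof -
    let ?S = "{x \<in> ?V. \<kappa> x = c}" and ?R = "{y \<in> U. \<kappa> y = c \<and> y \<in> nbhd H X}"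
    have "card ?S < card (?S \<inter> nbhd H X) + 2 * m"
      using X U by (intro weak_expander_large[OF fV exp2]) auto
    moreover have "card (?S \<inter> nbhd H X) \<le> card (?R \<union> (?V - U))"
      using fV U finite_subset[OF U(1)] by (intro card_mono) auto
    moreover have "\<dots> \<le> card ?R + card (?V - U)" by (rule card_Un_le)
    ultimately have 1: "card ?S < card ?R + 4 * m" using U by linarith
    have 2: "2 * m * D = 2 * q" by (simp add: q_def)
    \<comment> \<open>Non-neighbours and deleted vertices cost less than \<open>4 * m\<close> in
      all. Inside \<open>M\<close>, \<open>8 * q - 4 * m\<close> is at least
      \<open>2 * m + 2 * q\<close>. Outside \<open>M\<close> the slack comes from the leaves:
      \<open>card A\<close> is at most \<open>n - 24 * q + 1\<close>.\<close>
    show ?thesis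
    proof (cases c)
      case True
      then have "card ?S = 8 * q" "card {t \<in> A. col t = c} = 2 * m"
        using sizes[of c] colour[of c] by auto
      then show ?thesis using 1 2 q by linarith
    next
      case False
      then have "card ?S = n - 8 * q" "card {t \<in> A. col t = c} = card A - 2 * m"
        using sizes[of c] colour[of c] by auto
      then show ?thesis using 1 2 q nq cA cL m1(2) by linarith
    qed
  qed
  have inhabited: "\<exists>y\<in>U. \<kappa> y = c" for c
  proof -
    have "\<exists>x\<in>{x \<in> ?V. \<kappa> x = c}. x \<notin> ?V - U"
    proof (rule ccontr)
      assume "\<not> ?thesis"
      then have "card {x \<in> ?V. \<kappa> x = c} \<le> card (?V - U)" using fV by (intro card_mono) auto
      then show False using U(2) q nq unfolding sizes by (cases c) auto
    qed
    then show ?thesis by blast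
  qed
  obtain f d where inj: "inj_on f A" and fA: "f ` A \<subseteq> U" and colf: "\<forall>t\<in>A. \<kappa> (f t) = col t"
    and edge: "\<forall>t\<in>A - {r}. {f (par t), f t} \<in> edges H"
    and dch: "\<forall>c. \<forall>s\<in>A. card {t \<in> ?W - A. par t = s \<and> col t = c} \<le> d c (f s)"
    and ext: "\<forall>X c. X \<subseteq> U \<longrightarrow> card X \<le> 2 * m \<longrightarrow>
      sum (d c) X \<le> card ({y \<in> U. \<kappa> y = c \<and> y \<in> nbhd H X} - f ` A)"
  proof -
    have "finite U" using U fV finite_subset by blast
    note emb = coloured_tree_embedding[of U ?W r A rank par D \<kappa> m H col,
      OF this fW rA(1,2) _ _ deg inhabited expand large]
    show thesis
      by (rule emb[THEN exE]) (use par parA rA that in auto)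
  qed
  have fAV: "f ` A \<subseteq> ?V" using fA U by blast

  \<comment> \<open>Placing the leaves by Hall's theorem\<close>
  define R where "R = ?V - f ` A"
  have cR: "Suc (card R) = card L + m1"
  proof -
    have "card (f ` A) = card A" using card_image[OF inj] .
    then have "card R = n - card A"
      unfolding R_def using fAV fV H by (metis card_Diff_subset finite_subset)
    then show ?thesis using cA nq card_mono[OF fV fAV] \<open>card (f ` A) = card A\<close> H by linarith
  qed
  define N where "N l = nbhd H {f (par l)} \<inter> R" for l
  have "card J \<le> card (\<Union>(N ` J))" if J: "J \<subseteq> L" for J
  proof (rule ccontr)
    assume less: "\<not> ?thesis"
    define X where "X = f ` par ` J"
    have fJ: "finite J" using J LW finite_subset by blast
    have pJ: "par ` J \<subseteq> A" using J LWr parA by blast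
    have XU: "X \<subseteq> U" "X \<subseteq> f ` A" "X \<subseteq> ?V" using pJ fA fAV by (auto simp: X_def)
    have UN: "\<Union>(N ` J) = nbhd H X \<inter> R" by (auto simp: N_def X_def nbhd_def)
    show False
    proof (cases "card X \<le> 2 * m")
      case True
      have "card J \<le> card (\<Union>p\<in>par ` J. {l \<in> L. par l = p})"
        using J fJ LW by (intro card_mono) auto
      also have "\<dots> \<le> (\<Sum>p\<in>par ` J. card {l \<in> L. par l = p})"
        using fJ by (intro card_UN_le) auto
      also have "\<dots> \<le> (\<Sum>p\<in>par ` J. d False (f p))"
      proof (rule sum_mono)
        fix p assume "p \<in> par ` J"
        then have "card {t \<in> ?W - A. par t = p \<and> col t = False} \<le> d False (f p)"
          using dch pJ by blast
        moreover have "{t \<in> ?W - A. par t = p \<and> col t = False} = {l \<in> L. par l = p}"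
          using PA LW by (auto simp: col_def A_def)
        ultimately show "card {l \<in> L. par l = p} \<le> d False (f p)" by simp
      qed
      also have "\<dots> = sum (d False) X"
        unfolding X_def using inj_on_subset[OF inj pJ] by (simp add: sum.reindex)
      also have "\<dots> \<le> card ({y \<in> U. \<kappa> y = False \<and> y \<in> nbhd H X} - f ` A)"
        using ext XU True by blast
      also have "\<dots> \<le> card (\<Union>(N ` J))"
        unfolding UN R_def using fV U by (intro card_mono) auto
      finally show False using less by simp
    next
      case False
      define Y where "Y = R - nbhd H X"
      have YV: "Y \<subseteq> ?V" "X \<inter> Y = {}" using XU by (auto simp: Y_def R_def)
      have fR: "finite R" using fV by (simp add: R_def)
      have "card R = card (nbhd H X \<inter> R) + card Y"
        using card_Int_Diff[OF fR, of "nbhd H X"] by (simp add: Y_def Int_commute)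
      moreover have "card L = card J + card (L - J)"
        using J LW fJ by (simp add: card_Diff_subset card_mono)
      \<comment> \<open>\<open>R\<close> has \<open>card L + m1 - 1\<close> elements, at most
        \<open>card J - 1\<close> of them adjacent to \<open>X\<close>; the two ones cancel.\<close>
      ultimately have cY: "card (L - J) + m1 \<le> card Y" using cR less UN by simp
      have "card Y < m"
      proof (rule ccontr)
        assume "\<not> ?thesis"
        then have "Y \<inter> nbhd H X \<noteq> {}"
          using False XU YV by (intro weak_expander_nbhd[OF exp2]) auto
        then show False by (auto simp: Y_def)
      qed
      obtain Y0 where Y0: "Y0 \<subseteq> Y" "card Y0 = m1"
        using cY by (meson obtain_subset_with_card_n add_leE)
      have "?V - Y0 - nbhd H Y0 \<in> Z" using Y0 YV unfolding Z_def by blast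
      then have "card (M \<inter> (?V - Y0 - nbhd H Y0)) < m" by (rule MZ)
      moreover have "X \<inter> f ` P \<subseteq> M \<inter> (?V - Y0 - nbhd H Y0)"
      proof
        fix x assume x: "x \<in> X \<inter> f ` P"
        then have "x \<in> M" using colf PA by (auto simp: \<kappa>_def col_def)
        moreover have "x \<notin> nbhd H Y0"
        proof
          assume "x \<in> nbhd H Y0"
          then obtain y where "y \<in> Y0" "{y, x} \<in> edges H" by (auto simp: nbhd_def)
          then have "y \<in> Y" "y \<in> nbhd H X" using Y0 x by (auto simp: nbhd_def insert_commute)
          then show False by (simp add: Y_def)
        qed
        ultimately show "x \<in> M \<inter> (?V - Y0 - nbhd H Y0)" using x XU YV Y0 by auto
      qed
      moreover have "finite M" using M fV finite_subset by blast
      ultimately have "card (X \<inter> f ` P) < m"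
        by (meson card_mono finite_Int le_less_trans)
      moreover have "card (f ` P) = 2 * m" using P inj_on_subset[OF inj PA] by (simp add: card_image)
      moreover have "card (f ` P) = card (X \<inter> f ` P) + card (f ` P - X)"
        using card_Int_Diff[of "f ` P" X] fP by (simp add: Int_commute)
      \<comment> \<open>More than \<open>m\<close> images of \<open>P\<close> lie outside
        \<open>X\<close>. Each of these parents has a child in \<open>L\<close>, which cannot be in
        \<open>J\<close>. Hence \<open>card (L - J)\<close> exceeds \<open>m\<close> and so
        \<open>card Y\<close>, against \<open>cY\<close>.\<close>
      moreover have "card (f ` P - X) \<le> card (L - J)"
      proof -
        have "f ` P - X \<subseteq> (\<lambda>l. f (par l)) ` (L - J)" using P(1) unfolding X_def by blast
        then show ?thesis using LW by (intro surj_card_le) auto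
      qed
      ultimately show False using cY \<open>card Y < m\<close> by linarith
    qed
  qed
  then obtain g where g: "inj_on g L" "\<forall>l\<in>L. g l \<in> N l"
    using hall_marriage[of L N] LW fV by (auto simp: N_def R_def)
  define F where "F v = (if v \<in> A then f v else g v)" for v
  have WAL: "?W = A \<union> L" using LW by (auto simp: A_def)
  have gR: "g l \<in> ?V" "g l \<notin> f ` A" if "l \<in> L" for l using g that by (auto simp: N_def R_def)
  have "inj_on F ?W"
    unfolding inj_on_def
  proof (intro ballI impI)
    fix v w assume vw: "v \<in> ?W" "w \<in> ?W" "F v = F w"
    then have "v \<in> A \<or> v \<in> L" "w \<in> A \<or> w \<in> L" using WAL by auto
    then show "v = w"
      using vw(3) inj g(1) gR(2) unfolding F_def
      by (metis imageI inj_onD)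
  qed
  moreover have "F ` ?W \<subseteq> ?V" using WAL fAV gR by (auto simp: F_def)
  moreover have "F ` e \<in> edges H" if e: "e \<in> edges T" for e
  proof -
    obtain v where v: "v \<in> ?W - {r}" "e = {v, par v}" using e ET by blast
    have Fe: "F ` e = {F v, f (par v)}" using v parA[OF v(1)] by (simp add: F_def)
    show ?thesis
    proof (cases "v \<in> A")
      case True
      then show ?thesis using Fe edge v by (auto simp: F_def insert_commute)
    next
      case False
      then have "g v \<in> N v" using g v WAL by blast
      then show ?thesis using Fe False by (auto simp: F_def N_def nbhd_def insert_commute)
    qed
  qed
  ultimately show ?thesis unfolding contains_copy_def by blast
qed

theorem theorem3p4:
  shows "\<exists>n0::nat. \<forall>n\<ge>n0. \<forall>m1 m2 D :: nat. \<forall>H :: 'a graph.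
    n > 0 \<and> m1 > 0 \<and> m2 > 0 \<and> D > 0 \<and>
    6 * real m1 * ln (real n) < real m2 \<and> 16 * D * m2 \<le> n \<and>
    simple_graph H \<and> card (verts H) = n \<and>
    weak_expander H m1 (nat \<lceil>real n / (32 * real D)\<rceil>) \<and> weak_expander H m2 m2
    \<longrightarrow> (\<forall>T :: 'b graph. T \<in> bounded_degree_trees (n - m1) D \<and> card (leaves T) \<ge> 24 * D * m2
          \<longrightarrow> contains_copy H T)"
  by (intro exI[of _ 0] allI impI) (elim conjE, rule embedding_with_many_leaves)

end
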